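(* Let $S$ be a $*$-monoid, let $a,b,c\in S$ and $k\in\mathbb{N}$. In conditions (ii)–(iv) and in the formulae below, $d=((ca)^kc)^{(1,3)}ca$, where $((ca)^kc)^{(1,3)}$ is a $\{1,3\}$-inverse of $(ca)^kc$ (whose existence is understood as part of each of these conditions). Then the following conditions are equivalent: (i) $a$ is $(b,c)$-core-EP invertible with $k\in {\rm I}_{(b,c)}(a)$. (ii) $(ca)^{k}c$ is $\{1,3\}$-invertible and $d$ is $((ca)^{k}b,(ca)^{k}c)$-invertible. (iii) $(ca)^{k+1}$ is $\{1,3\}$-invertible and $d$ is $((ca)^{k}b,(ca)^{k}c)$-invertible. (iv) $(ca)^{k+1}b$ is $\{1,3\}$-invertible and $d$ is $((ca)^{k}b,(ca)^{k}c)$-invertible. In this case, the $(b,c)$-core-EP inverse $a_{(b,c)}^{D}$ of $a$ satisfies $$a_{(b,c)}^{D}=d^{((ca)^{k}b,(ca)^{k}c)}((ca)^{k}c)^{(1,3)}=d^{((ca)^{k}b,(ca)^{k}c)}\,a\,((ca)^{k+1})^{(1,3)}=(ca)^{k}b\,((ca)^{k+1}b)^{(1,3)}.$$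
   Context: $\mathbb{N}=\{0,1,2,\dots\}$. A $*$-monoid is a monoid $S$ with unity $1$ and an involution $*:S\to S$ satisfying $(a^* )^*=a$ and $(ab)^*=b^*a^*$. $u\mathrel{\mathcal R}v$ iff $uS=vS$; $u\mathrel{\mathcal L}v$ iff $Su=Sv$. $a$ is $(b,c)$-core-EP invertible if there exist $x\in S$ and $k\in\mathbb{N}$ such that $cax(ca)^{k}c=(ca)^{k}c$, $x\mathrel{\mathcal R}(ca)^{k}b$ and $x\mathrel{\mathcal L}((ca)^{k}c)^{*}$. ${\rm I}_{(b,c)}(a)$ is the set of all $k\in\mathbb{N}$ for which such an $x$ exists. For the given $k\in {\rm I}_{(b,c)}(a)$, $a_{(b,c)}^{D}$ denotes the element $x$ satisfying these conditions with that $k$. A $\{1,3\}$-inverse of $u\in S$ is an element $y\in S$ with $uyu=u$ and $(uy)^*=uy$; $u^{(1,3)}$ denotes any $\{1,3\}$-inverse of $u$, and $u$ is $\{1,3\}$-invertible if one exists. For $u,v,w\in S$, $u$ is $(v,w)$-invertible (in the sense of Drazin) if there exists $y\in S$ with $y\in vSy\cap ySw$, $yuv=v$ and $wuy=w$; such $y$ is unique and is denoted $u^{(v,w)}$. *)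

theory Defs
  imports Main
begin

class star_monoid = monoid_mult +
  fixes star :: "'a \<Rightarrow> 'a"
  assumes star_star: "star (star a) = a"
    and star_mult: "star (a * b) = star b * star a"

context star_monoid
begin

definition green_R :: "'a \<Rightarrow> 'a \<Rightarrow> bool" where
  "green_R u v \<longleftrightarrow> {u * s | s. True} = {v * s | s. True}"

definition green_L :: "'a \<Rightarrow> 'a \<Rightarrow> bool" where
  "green_L u v \<longleftrightarrow> {s * u | s. True} = {s * v | s. True}"

definition is_inverse13 :: "'a \<Rightarrow> 'a \<Rightarrow> bool" where
  "is_inverse13 u y \<longleftrightarrow> u * y * u = u \<and> star (u * y) = u * y"

definition invertible13 :: "'a \<Rightarrow> bool" where
  "invertible13 u \<longleftrightarrow> (\<exists>y. is_inverse13 u y)"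

definition is_vw_inverse :: "'a \<Rightarrow> 'a \<Rightarrow> 'a \<Rightarrow> 'a \<Rightarrow> bool" where
  "is_vw_inverse v w u y \<longleftrightarrow>
     y \<in> {v * s * y | s. True} \<inter> {y * s * w | s. True} \<and> y * u * v = v \<and> w * u * y = w"

definition vw_invertible :: "'a \<Rightarrow> 'a \<Rightarrow> 'a \<Rightarrow> bool" where
  "vw_invertible v w u \<longleftrightarrow> (\<exists>y. is_vw_inverse v w u y)"

definition vw_inverse :: "'a \<Rightarrow> 'a \<Rightarrow> 'a \<Rightarrow> 'a" where
  "vw_inverse v w u = (THE y. is_vw_inverse v w u y)"

definition is_core_EP_inverse :: "'a \<Rightarrow> 'a \<Rightarrow> nat \<Rightarrow> 'a \<Rightarrow> 'a \<Rightarrow> bool" where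
  "is_core_EP_inverse b c k a x \<longleftrightarrow>
     c * a * x * (c * a) ^ k * c = (c * a) ^ k * c \<and>
     green_R x ((c * a) ^ k * b) \<and>
     green_L x (star ((c * a) ^ k * c))"

definition core_EP_invertible :: "'a \<Rightarrow> 'a \<Rightarrow> 'a \<Rightarrow> bool" where
  "core_EP_invertible b c a \<longleftrightarrow> (\<exists>x k. is_core_EP_inverse b c k a x)"

definition core_EP_indices :: "'a \<Rightarrow> 'a \<Rightarrow> 'a \<Rightarrow> nat set" where
  "core_EP_indices b c a = {k. \<exists>x. is_core_EP_inverse b c k a x}"

definition core_EP_inverse :: "'a \<Rightarrow> 'a \<Rightarrow> nat \<Rightarrow> 'a \<Rightarrow> 'a" where
  "core_EP_inverse b c k a = (THE x. is_core_EP_inverse b c k a x)"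

text \<open>The next two facts justify the definite descriptions above.\<close>

lemma is_vw_inverse_unique:
  assumes y: "is_vw_inverse v w u y" and z: "is_vw_inverse v w u z"
  shows "y = z"
proof -
  obtain s where s: "y = y * s * w" and y': "y * u * v = v"
    using y unfolding is_vw_inverse_def by blast
  obtain t where t: "z = v * t * z" and z': "w * u * z = w"
    using z unfolding is_vw_inverse_def by blast
  have "y = y * s * (w * u * z)" using s z' by simp
  also have "\<dots> = (y * s * w) * u * z" by (simp only: mult.assoc)
  also have "\<dots> = y * u * z" using s by simp
  also have "\<dots> = y * u * (v * t * z)" using t by simp
  also have "\<dots> = (y * u * v) * t * z" by (simp only: mult.assoc)
  also have "\<dots> = z" using y' t by simp
  finally show ?thesis .
qed

lemma is_core_EP_inverse_unique:
  assumes x: "is_core_EP_inverse b c k a x" and y: "is_core_EP_inverse b c k a y"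
  shows "x = y"
proof -
  define m where "m = c * a"
  define w where "w = m ^ k * c"
  have m_v: "m * (m ^ k * b) = w * (a * b)"
  proof -
    have "m * (m ^ k * b) = (m ^ k * m) * b" by (simp add: mult.assoc power_commutes)
    thus ?thesis by (simp add: w_def m_def mult.assoc)
  qed
  have proj: "\<exists>r. m * z = w * r" "m * z * w = w" "star (m * z) = m * z" "z * (m * z) = z"
    if z: "is_core_EP_inverse b c k a z" for z
  proof -
    show zw: "m * z * w = w"
      using z unfolding is_core_EP_inverse_def w_def m_def by (simp add: mult.assoc)
    have "z \<in> {z * s | s. True}" by (rule CollectI, rule exI[of _ 1]) simp
    then obtain r where r: "z = m ^ k * b * r"
      using z unfolding is_core_EP_inverse_def green_R_def m_def by blast
    have "z \<in> {s * z | s. True}" by (rule CollectI, rule exI[of _ 1]) simp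
    then obtain l where l: "z = l * star w"
      using z unfolding is_core_EP_inverse_def green_L_def m_def w_def by blast
    show "\<exists>r. m * z = w * r" using m_v r by (metis mult.assoc)
    have "m * z * star (m * z) = star (m * z)"
    proof -
      have "star (m * z) = w * star (m * l)"
        by (metis l mult.assoc star_mult star_star)
      thus ?thesis using zw by (metis mult.assoc)
    qed
    thus h: "star (m * z) = m * z" by (metis star_mult star_star)
    have "star w * (m * z) = star w" using zw h by (metis star_mult)
    thus "z * (m * z) = z" using l by (metis mult.assoc)
  qed
  have "m * x = m * y"
  proof -
    have "m * y * (m * x) = m * x" "m * x * (m * y) = m * y"
      using proj(1,2)[OF x] proj(1,2)[OF y] by (metis mult.assoc)+
    thus ?thesis using proj(3)[OF x] proj(3)[OF y] by (metis star_mult)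
  qed
  moreover obtain r where "y = x * r"
  proof -
    have "y \<in> {y * s | s. True}" by (rule CollectI, rule exI[of _ 1]) simp
    thus ?thesis using that x y unfolding is_core_EP_inverse_def green_R_def by blast
  qed
  ultimately show ?thesis using proj(4)[OF x] proj(4)[OF y] by (metis mult.assoc)
qed

end

end

theory Submission
  imports Defs
begin

text \<open>
  Put \<open>m = c a\<close>, \<open>v = m\<^sup>k b\<close>, \<open>w = m\<^sup>k c\<close>, so that \<open>m v = w a b\<close> and \<open>m\<^bsup>k+1\<^esup> = w a\<close>.  For a
  \<open>(b,c)\<close>-core-EP inverse \<open>x\<close>, the element \<open>m x\<close> is the hermitian idempotent generating each of
  the right ideals \<open>w S = w a S = w a b S\<close>, which gives all three \<open>{1,3}\<close>-inverses, and \<open>x w\<close> is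
  the \<open>(v,w)\<close>-inverse of \<open>d = g m\<close>.  Conversely, if \<open>y\<close> is the \<open>(v,w)\<close>-inverse of \<open>d\<close>, then
  \<open>m y = w\<close> and \<open>y g\<close> is the core-EP inverse.  The formulas hold since a hermitian idempotent is
  determined by the right ideal it generates.
\<close>

text \<open>Elements generating the same right ideal give hermitian idempotents that absorb each
  other on the left; applying \<open>star\<close> to one of these products swaps its factors and
  identifies the two.\<close>

lemma is_inverse13_proj_eq:
  fixes u u' :: "'a::star_monoid"
  assumes y: "is_inverse13 u y" and y': "is_inverse13 u' y'"
    and p: "u = u' * p" and q: "u' = u * q"
  shows "u * y = u' * y'"
proof -
  have "(u' * y') * (u * y) = u * y" "(u * y) * (u' * y') = u' * y'"
    using y y' p q unfolding is_inverse13_def by (metis mult.assoc)+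
  thus ?thesis
    using y y' unfolding is_inverse13_def by (metis star_mult)
qed

lemma is_inverse13I_proj:
  fixes u :: "'a::star_monoid"
  assumes "star e = e" and "e * u = u" and "e = u * y"
  shows "is_inverse13 u y"
  using assms unfolding is_inverse13_def by simp

lemma green_R_iff:
  fixes u v :: "'a::star_monoid"
  shows "green_R u v \<longleftrightarrow> (\<exists>r. u = v * r) \<and> (\<exists>r. v = u * r)"
proof
  assume R: "green_R u v"
  have "u \<in> {u * s | s. True}" "v \<in> {v * s | s. True}"
    by (rule CollectI, rule exI[of _ 1], simp)+
  thus "(\<exists>r. u = v * r) \<and> (\<exists>r. v = u * r)"
    using R unfolding green_R_def by blast
next
  assume "(\<exists>r. u = v * r) \<and> (\<exists>r. v = u * r)"
  then obtain r r' where "u = v * r" "v = u * r'" by blast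
  thus "green_R u v" unfolding green_R_def set_eq_iff mem_Collect_eq
    by (metis mult.assoc)
qed

lemma green_L_iff:
  fixes u v :: "'a::star_monoid"
  shows "green_L u v \<longleftrightarrow> (\<exists>l. u = l * v) \<and> (\<exists>l. v = l * u)"
proof
  assume L: "green_L u v"
  have "u \<in> {s * u | s. True}" "v \<in> {s * v | s. True}"
    by (rule CollectI, rule exI[of _ 1], simp)+
  thus "(\<exists>l. u = l * v) \<and> (\<exists>l. v = l * u)"
    using L unfolding green_L_def by blast
next
  assume "(\<exists>l. u = l * v) \<and> (\<exists>l. v = l * u)"
  then obtain l l' where "u = l * v" "v = l' * u" by blast
  thus "green_L u v" unfolding green_L_def set_eq_iff mem_Collect_eq
    by (metis mult.assoc)
qed

lemma vw_inverse_eqI: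
  fixes v w u y :: "'a::star_monoid"
  assumes "is_vw_inverse v w u y"
  shows "vw_inverse v w u = y"
  unfolding vw_inverse_def using assms is_vw_inverse_unique by blast

lemma core_EP_inverse_eqI:
  fixes a b c x :: "'a::star_monoid"
  assumes "is_core_EP_inverse b c k a x"
  shows "core_EP_inverse b c k a = x"
  unfolding core_EP_inverse_def using assms is_core_EP_inverse_unique by blast

context
  fixes a b c :: "'a::star_monoid" and k :: nat
  fixes m v w
  defines "m \<equiv> c * a" and "v \<equiv> m ^ k * b" and "w \<equiv> m ^ k * c"
begin

lemma m_power_Suc: "m ^ (k + 1) = w * a"
  by (simp add: w_def m_def mult.assoc flip: power_Suc2 power_Suc)

lemma m_mult_v: "m * v = w * a * b"
  unfolding v_def m_power_Suc[symmetric] by (simp add: mult.assoc)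

lemma is_core_EP_inverse_iff:
  "is_core_EP_inverse b c k a x \<longleftrightarrow> m * x * w = w \<and>
     (\<exists>r. x = v * r) \<and> (\<exists>r. v = x * r) \<and> (\<exists>l. x = l * star w) \<and> (\<exists>l. star w = l * x)"
  unfolding is_core_EP_inverse_def green_R_iff green_L_iff v_def w_def m_def
  by (simp add: mult.assoc)

text \<open>As \<open>x\<close> is a left multiple of \<open>star w\<close>,
  \<open>star (m * x)\<close> is a right multiple of \<open>w\<close>, hence fixed by
  \<open>m * x\<close>; so it equals \<open>m * x * star (m * x)\<close>, which is
  hermitian.\<close>

lemma is_core_EP_inverse_proj:
  assumes "is_core_EP_inverse b c k a x"
  shows "star (m * x) = m * x" and "x * (m * x) = x"
proof -
  obtain l where l: "x = l * star w" and mxw: "m * x * w = w"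
    using assms unfolding is_core_EP_inverse_iff by blast
  have "star (m * x) = w * star (m * l)"
    by (metis l mult.assoc star_mult star_star)
  hence "m * x * star (m * x) = star (m * x)" using mxw by (metis mult.assoc)
  thus herm: "star (m * x) = m * x" by (metis star_mult star_star)
  have "star w * (m * x) = star w" using mxw herm by (metis star_mult)
  thus "x * (m * x) = x" using l by (metis mult.assoc)
qed

lemma is_core_EP_inverse_imp_invertible13:
  assumes x: "is_core_EP_inverse b c k a x"
  shows "invertible13 w" and "invertible13 (w * a)" and "invertible13 (w * a * b)"
proof -
  obtain r where mxw: "m * x * w = w" and r: "x = v * r"
    using x unfolding is_core_EP_inverse_iff by blast
  \<comment> \<open>One factorization serves all three elements: splitting it after
    \<open>w\<close>, \<open>w * a\<close> or \<open>w * a * b\<close> leaves the respective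
    \<open>{1,3}\<close>-inverse.\<close>
  have mx: "m * x = w * a * b * r" using m_mult_v r by (simp flip: mult.assoc)
  note herm = is_core_EP_inverse_proj(1)[OF x]
  have "is_inverse13 w (a * b * r)" "is_inverse13 (w * a) (b * r)" "is_inverse13 (w * a * b) r"
    using mx mxw by (auto intro!: is_inverse13I_proj[OF herm] simp flip: mult.assoc)
  thus "invertible13 w" "invertible13 (w * a)" "invertible13 (w * a * b)"
    unfolding invertible13_def by blast+
qed

lemma is_vw_inverse_of_core_EP:
  assumes x: "is_core_EP_inverse b c k a x" and g: "is_inverse13 w g"
  shows "is_vw_inverse v w (g * m) (x * w)"
proof -
  obtain r r' where mxw: "m * x * w = w" and r: "x = v * r" and r': "v = x * r'"
    using x unfolding is_core_EP_inverse_iff by blast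
  have xmx: "x * m * x = x" using is_core_EP_inverse_proj(2)[OF x] by (simp add: mult.assoc)
  have wgw: "w * g * w = w" using g unfolding is_inverse13_def by simp
  \<comment> \<open>Writing \<open>m * v\<close> as a right multiple of \<open>w\<close> lets
    \<open>w * g * w = w\<close> cancel \<open>g\<close>.\<close>
  have "x * w * (g * m) * v = x * ((w * g * w) * (a * b))"
    using m_mult_v by (simp add: mult.assoc)
  also have "\<dots> = x * m * x * r'"
    using m_mult_v r' wgw by (simp add: mult.assoc)
  finally have 1: "x * w * (g * m) * v = v" using xmx r' by simp
  have "w * (g * m) * (x * w) = w * g * (m * x * w)" by (simp add: mult.assoc)
  hence 2: "w * (g * m) * (x * w) = w" using mxw wgw by simp
  \<comment> \<open>The middle factor \<open>r * m\<close> comes from \<open>x = v * r\<close> and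
    \<open>x * m * x = x\<close>.\<close>
  have "v * (r * m) * (x * w) = (v * r) * m * x * w" by (simp add: mult.assoc)
  hence 3: "x * w = v * (r * m) * (x * w)" using r xmx by simp
  have 4: "x * w = x * w * g * w" using wgw by (simp add: mult.assoc)
  show ?thesis unfolding is_vw_inverse_def using 1 2 3 4 by blast
qed

context
  fixes g y
  assumes g: "is_inverse13 w g" and y: "is_vw_inverse v w (g * m) y"
begin

text \<open>\<open>m * y\<close> is a right multiple of \<open>m * v\<close>, hence of
  \<open>w\<close>, so \<open>w * g\<close> fixes it; but \<open>w * g * m * y = w\<close>.\<close>

lemma m_mult_vw_inverse: "m * y = w"
proof -
  obtain t where t: "y = v * t * y" and wd: "w * (g * m) * y = w"
    using y unfolding is_vw_inverse_def by blast
  have "w * g * (m * v) = m * v"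
    using g m_mult_v unfolding is_inverse13_def by (simp flip: mult.assoc)
  hence "w * g * (m * y) = m * y" using t by (metis mult.assoc)
  thus ?thesis using wd by (simp add: mult.assoc)
qed

lemma is_core_EP_inverse_of_vw: "is_core_EP_inverse b c k a (y * g)"
proof -
  obtain s t where s: "y = y * s * w" and t: "y = v * t * y" and dv: "y * (g * m) * v = v"
    using y unfolding is_vw_inverse_def by blast
  have wgw: "w * g * w = w" and herm: "star (w * g) = w * g"
    using g unfolding is_inverse13_def by auto
  have "y * g * w = y" using s wgw by (metis mult.assoc)
  hence "m * (y * g) * w = w" using m_mult_vw_inverse by (simp add: mult.assoc)
  moreover have "y * g = v * (t * y * g)" using t by (metis mult.assoc)
  moreover have "v = y * g * (m * v)" using dv by (simp add: mult.assoc)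
  \<comment> \<open>Here \<open>w * g\<close> is replaced by its own star.\<close>
  moreover have "y * g = y * s * star g * star w"
    using s herm by (metis mult.assoc star_mult)
  \<comment> \<open>This is the star of \<open>w = w * g * w\<close>, with
    \<open>w * g = m * y * g\<close>.\<close>
  moreover have "star w = star w * m * (y * g)"
    using wgw herm m_mult_vw_inverse by (metis mult.assoc star_mult)
  ultimately show ?thesis unfolding is_core_EP_inverse_iff by blast
qed

lemma core_EP_inverse_formulas:
  assumes h: "is_inverse13 (w * a) h" and e: "is_inverse13 (w * a * b) e"
  shows "y * g = y * a * h" and "y * g = v * e"
proof -
  obtain s t where s: "y = y * s * w" and t: "y = v * t * y" and dv: "y * (g * m) * v = v"
    using y unfolding is_vw_inverse_def by blast
  \<comment> \<open>Thus \<open>w\<close>, \<open>w * a\<close> and \<open>w * a * b\<close>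
    generate the same right ideal, and their hermitian idempotents coincide.\<close>
  have w: "w = w * a * b * (t * y)"
    using m_mult_vw_inverse m_mult_v t by (metis mult.assoc)
  have wg_h: "w * g = w * a * h"
    by (rule is_inverse13_proj_eq[OF g h, of "b * (t * y)" a]) (use w in \<open>simp_all add: mult.assoc\<close>)
  have wg_e: "w * g = w * a * b * e"
    by (rule is_inverse13_proj_eq[OF g e, of "t * y" "a * b"]) (use w in \<open>simp_all add: mult.assoc\<close>)
  show "y * g = y * a * h" using s wg_h by (metis mult.assoc)
  \<comment> \<open>The inner \<open>m * (y * g)\<close> is \<open>w * g\<close>, which turns into
    \<open>m * v * e\<close>.\<close>
  have "y * g = y * g * (m * (y * g))"
    using is_core_EP_inverse_proj(2)[OF is_core_EP_inverse_of_vw] by simp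
  also have "\<dots> = y * g * (m * v) * e"
    using m_mult_vw_inverse wg_e m_mult_v by (metis mult.assoc)
  also have "\<dots> = v * e" using dv by (simp add: mult.assoc)
  finally show "y * g = v * e" .
qed

end

end

theorem theorem3p15:
  fixes a b c :: "'a::star_monoid" and k :: nat
  defines "v \<equiv> (c * a) ^ k * b" and "w \<equiv> (c * a) ^ k * c"
  shows
    "((core_EP_invertible b c a \<and> k \<in> core_EP_indices b c a) \<longleftrightarrow>
        invertible13 w \<and> (\<exists>g. is_inverse13 w g \<and> vw_invertible v w (g * c * a)))
     \<and> ((core_EP_invertible b c a \<and> k \<in> core_EP_indices b c a) \<longleftrightarrow>
        invertible13 ((c * a) ^ (k + 1)) \<and> (\<exists>g. is_inverse13 w g \<and> vw_invertible v w (g * c * a)))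
     \<and> ((core_EP_invertible b c a \<and> k \<in> core_EP_indices b c a) \<longleftrightarrow>
        invertible13 ((c * a) ^ (k + 1) * b) \<and> (\<exists>g. is_inverse13 w g \<and> vw_invertible v w (g * c * a)))
     \<and> (core_EP_invertible b c a \<and> k \<in> core_EP_indices b c a \<longrightarrow>
        (\<forall>g h e. is_inverse13 w g \<and> is_inverse13 ((c * a) ^ (k + 1)) h \<and>
                 is_inverse13 ((c * a) ^ (k + 1) * b) e \<longrightarrow>
          (let d = g * c * a in
            vw_invertible v w d \<and>
            core_EP_inverse b c k a = vw_inverse v w d * g \<and>
            core_EP_inverse b c k a = vw_inverse v w d * a * h \<and>
            core_EP_inverse b c k a = v * e)))"
proof -
  let ?i = "core_EP_invertible b c a \<and> k \<in> core_EP_indices b c a"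
  let ?d = "\<exists>g. is_inverse13 w g \<and> vw_invertible v w (g * c * a)"
  have i_iff: "?i \<longleftrightarrow> (\<exists>x. is_core_EP_inverse b c k a x)"
    unfolding core_EP_invertible_def core_EP_indices_def by blast
  have power: "(c * a) ^ (k + 1) = w * a"
    unfolding w_def by (rule m_power_Suc)
  have vwI: "is_vw_inverse v w (g * c * a) (x * w)"
    if "is_core_EP_inverse b c k a x" "is_inverse13 w g" for x g
    using is_vw_inverse_of_core_EP[OF that[unfolded w_def]]
    unfolding v_def w_def by (simp add: mult.assoc)
  have epI: "is_core_EP_inverse b c k a (y * g)"
    if "is_inverse13 w g" "is_vw_inverse v w (g * c * a) y" for g y
    using is_core_EP_inverse_of_vw that unfolding v_def w_def by (metis mult.assoc)
  have inv: "invertible13 w \<and> invertible13 (w * a) \<and> invertible13 (w * a * b)" if ?i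
    using that is_core_EP_inverse_imp_invertible13 unfolding i_iff w_def by blast
  \<comment> \<open>Forwards, \<open>inv\<close> provides some \<open>g\<close> and
    \<open>vwI\<close> the inverse \<open>x * w\<close>; backwards, \<open>epI\<close> provides
    \<open>y * g\<close>.\<close>
  have d_iff: "?i \<longleftrightarrow> ?d"
    using inv vwI epI unfolding i_iff invertible13_def vw_invertible_def by blast
  have formulas: "vw_invertible v w (g * c * a) \<and>
      core_EP_inverse b c k a = vw_inverse v w (g * c * a) * g \<and>
      core_EP_inverse b c k a = vw_inverse v w (g * c * a) * a * h \<and>
      core_EP_inverse b c k a = v * e"
    if i: ?i and g: "is_inverse13 w g" and h: "is_inverse13 (w * a) h"
      and e: "is_inverse13 (w * a * b) e" for g h e
  proof -
    obtain y where y: "is_vw_inverse v w (g * c * a) y"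
      using i vwI g unfolding i_iff by blast
    have "is_vw_inverse v w (g * (c * a)) y" using y by (simp add: mult.assoc)
    hence "y * g = y * a * h" "y * g = v * e"
      using core_EP_inverse_formulas g h e unfolding v_def w_def by blast+
    moreover have "core_EP_inverse b c k a = y * g"
      by (rule core_EP_inverse_eqI[OF epI[OF g y]])
    ultimately show ?thesis
      using y vw_inverse_eqI[OF y] unfolding vw_invertible_def by metis
  qed
  show ?thesis
    unfolding power Let_def using inv d_iff formulas by blast
qed

end
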